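(* Let $X$ be an irreducible reduced hypersurface of degree $d\geq 3$ in $\mathbb{P}^N$ over $\mathbb{C}$, and let $\mathcal{S}$ be the set of $(N-2)$-dimensional linear subspaces $\Lambda$ of $\mathbb{P}^N$ contained in $X$ such that a general element of $\Lambda$ is a star point of $X$. If $\mathcal{S}$ has at least two elements, then one of the following two possibilities holds. (1) There exists a linear subspace $L$ of $\mathbb{P}^N$ of dimension $N-3$ such that every $\Lambda\in\mathcal{S}$ contains $L$. (2) There exists a linear subspace $H$ of $\mathbb{P}^N$ of dimension $N-1$ such that every $\Lambda\in\mathcal{S}$ is contained in $H$.
   Context: The ground field is $\mathbb{C}$. A smooth point $P$ of an irreducible reduced hypersurface $X\subset\mathbb{P}^N$ of degree $d\geq 3$ is called a star point on $X$ if the scheme $T_P(X)\cap X$ is a cone with vertex $P$, where $T_P(X)\subset\mathbb{P}^N$ is the embedded tangent hyperplane to $X$ at $P$; that is, in homogeneous coordinates $(Y_0:\dots:Y_{N-1})$ on $T_P(X)$ with $P=(1:0:\dots:0)$, the scheme $T_P(X)\cap X$ is defined by a form of degree $d$ not involving $Y_0$. "A general element of $\Lambda$" means all points of some nonempty Zariski open subset of $\Lambda$. The empty set is regarded as the linear subspace of dimension $-1$. *)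

theory Defs
  imports "HOL-Analysis.Analysis" "HOL-Library.Poly_Mapping"
    "HOL-Computational_Algebra.Factorial_Ring"
begin

section \<open>Projective space\<close>

text \<open>
  The projective space of dimension N is \<open>'n proj\<close> for an index type \<open>'n\<close> with N + 1 elements.
  Linear algebra over the complex numbers is the \<open>vec\<close> interpretation (\<open>vec.subspace\<close>,
  \<open>vec.span\<close>, \<open>vec.dim\<close>); the unqualified constants are about real scalars.
\<close>

typedef (overloaded) 'n proj =
  "{l :: (complex ^ 'n::finite) set. vec.subspace l \<and> vec.dim l = 1}"
  morphisms line_of Proj
proof -
  obtain i :: 'n where True by simp
  have "axis i (1::complex) \<noteq> 0" by (simp add: axis_eq_0_iff)
  then have "vec.independent {axis i (1::complex)}" by simp
  then have "vec.dim (vec.span {axis i (1::complex)}) = 1"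
    by (simp add: vec.dim_span_eq_card_independent)
  then show ?thesis using vec.subspace_span by blast
qed

text \<open>The dimension is an integer: \<open>W = {0}\<close> gives the empty set, of dimension \<open>-1\<close>.\<close>

definition proj_subspace :: "int \<Rightarrow> ('n::finite) proj set \<Rightarrow> bool" where
  "proj_subspace k L \<longleftrightarrow>
     (\<exists>W. vec.subspace W \<and> int (vec.dim W) - 1 = k \<and> L = {P. line_of P \<subseteq> W})"

section \<open>Polynomials in the variables indexed by \<open>'n\<close>\<close>

type_synonym 'n cpoly = "('n \<Rightarrow>\<^sub>0 nat) \<Rightarrow>\<^sub>0 complex"

definition homogeneous :: "nat \<Rightarrow> ('n::finite) cpoly \<Rightarrow> bool" where
  "homogeneous d F \<longleftrightarrow>
     (\<forall>m \<in> Poly_Mapping.keys F. (\<Sum>i\<in>UNIV. Poly_Mapping.lookup m i) = d)"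

definition cpoly_eval :: "('n::finite) cpoly \<Rightarrow> complex ^ 'n \<Rightarrow> complex" where
  "cpoly_eval F v = (\<Sum>m \<in> Poly_Mapping.keys F.
     Poly_Mapping.lookup F m * (\<Prod>i\<in>UNIV. (v $ i) ^ Poly_Mapping.lookup m i))"

text \<open>If \<open>i\<close> does not occur in \<open>m\<close>, the coefficient is 0, so the truncated subtraction is harmless.\<close>

definition partial_deriv :: "'n \<Rightarrow> ('n::finite) cpoly \<Rightarrow> 'n cpoly" where
  "partial_deriv i F = (\<Sum>m \<in> Poly_Mapping.keys F.
     Poly_Mapping.single (m - Poly_Mapping.single i 1)
       (of_nat (Poly_Mapping.lookup m i) * Poly_Mapping.lookup F m))"

definition cpoly_subst :: "('n \<Rightarrow> 'n cpoly) \<Rightarrow> ('n::finite) cpoly \<Rightarrow> 'n cpoly" where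
  "cpoly_subst g F = (\<Sum>m \<in> Poly_Mapping.keys F.
     Poly_Mapping.single 0 (Poly_Mapping.lookup F m) * (\<Prod>i\<in>UNIV. g i ^ Poly_Mapping.lookup m i))"

definition cpoly_var :: "'n \<Rightarrow> 'n cpoly" where
  "cpoly_var i = Poly_Mapping.single (Poly_Mapping.single i 1) 1"

definition involves :: "'n cpoly \<Rightarrow> 'n \<Rightarrow> bool" where
  "involves F i \<longleftrightarrow> (\<exists>m \<in> Poly_Mapping.keys F. Poly_Mapping.lookup m i \<noteq> 0)"

section \<open>Zariski topology\<close>

definition zero_locus :: "('n::finite) cpoly \<Rightarrow> 'n proj set" where
  "zero_locus F = {P. \<forall>v \<in> line_of P. cpoly_eval F v = 0}"

definition zariski_open :: "('n::finite) proj set \<Rightarrow> bool" where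
  "zariski_open U \<longleftrightarrow>
     (\<exists>G. (\<forall>g\<in>G. \<exists>k. homogeneous k g) \<and> U = - (\<Inter>g\<in>G. zero_locus g))"

text \<open>The Zariski open subsets of a linear subspace \<open>L\<close> are the sets \<open>U \<inter> L\<close> with \<open>U\<close> Zariski open.\<close>

definition general_element :: "('n::finite) proj set \<Rightarrow> ('n proj \<Rightarrow> bool) \<Rightarrow> bool" where
  "general_element L Q \<longleftrightarrow> (\<exists>U. zariski_open U \<and> U \<inter> L \<noteq> {} \<and> (\<forall>P \<in> U \<inter> L. Q P))"

section \<open>Star points\<close>

text \<open>
  In the following, the hypersurface is the closed subscheme defined by a form \<open>F\<close>;
  it is irreducible and reduced exactly when \<open>F\<close> is irreducible.
\<close>

definition smooth_point :: "('n::finite) cpoly \<Rightarrow> 'n proj \<Rightarrow> bool" where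
  "smooth_point F P \<longleftrightarrow> P \<in> zero_locus F \<and> (\<exists>i. P \<notin> zero_locus (partial_deriv i F))"

text \<open>The linear subspace of \<open>complex ^ 'n\<close> whose projectivization is the embedded tangent hyperplane.\<close>

definition tangent_hyperplane :: "('n::finite) cpoly \<Rightarrow> 'n proj \<Rightarrow> (complex ^ 'n) set" where
  "tangent_hyperplane F P =
     {y. \<forall>v \<in> line_of P. (\<Sum>i\<in>UNIV. cpoly_eval (partial_deriv i F) v * y $ i) = 0}"

text \<open>
  Homogeneous coordinates \<open>Y\<^sub>j\<close>, \<open>j \<in> J\<close>, on the projectivization of \<open>W\<close> are given by a basis
  \<open>b\<^sub>j\<close> of \<open>W\<close>: the vector with coordinates \<open>Y\<close> is \<open>\<Sum>j\<in>J. Y\<^sub>j b\<^sub>j\<close>. The point with coordinates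
  \<open>Y\<^sub>j = 1\<close> and all others 0 is the line through \<open>b\<^sub>j\<close>.
\<close>

definition homogeneous_coordinates ::
    "'n set \<Rightarrow> ('n \<Rightarrow> complex ^ 'n) \<Rightarrow> (complex ^ 'n::finite) set \<Rightarrow> bool" where
  "homogeneous_coordinates J b W \<longleftrightarrow>
     inj_on b J \<and> vec.independent (b ` J) \<and> vec.span (b ` J) = W"

text \<open>
  The form in the variables \<open>Y\<^sub>j\<close>, \<open>j \<in> J\<close>, obtained by substituting \<open>\<Sum>j\<in>J. Y\<^sub>j b\<^sub>j\<close> in \<open>F\<close>.
  In the coordinates given by \<open>b\<close> it defines the scheme-theoretic intersection of the
  hypersurface with the projectivization of \<open>W\<close>; a form of the same degree defining this
  scheme is unique up to a nonzero scalar factor.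
\<close>

definition restrict_form ::
    "'n set \<Rightarrow> ('n \<Rightarrow> complex ^ 'n) \<Rightarrow> ('n::finite) cpoly \<Rightarrow> 'n cpoly" where
  "restrict_form J b F =
     cpoly_subst (\<lambda>i. \<Sum>j\<in>J. Poly_Mapping.single 0 (b j $ i) * cpoly_var j) F"

definition star_point :: "('n::finite) cpoly \<Rightarrow> 'n proj \<Rightarrow> bool" where
  "star_point F P \<longleftrightarrow> smooth_point F P \<and>
     (\<exists>J b j0. homogeneous_coordinates J b (tangent_hyperplane F P) \<and>
        j0 \<in> J \<and> b j0 \<in> line_of P \<and> \<not> involves (restrict_form J b F) j0)"

text \<open>The set \<open>\<S>\<close>; the ambient projective space has dimension \<open>CARD('n) - 1\<close>.\<close>

definition star_subspaces :: "('n::finite) cpoly \<Rightarrow> 'n proj set set" where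
  "star_subspaces F =
     {\<Lambda>. proj_subspace (int CARD('n) - 3) \<Lambda> \<and> \<Lambda> \<subseteq> zero_locus F \<and>
         general_element \<Lambda> (star_point F)}"

end

theory Submission
  imports Defs
begin

text \<open>
  Let \<open>W\<close> be the linear space of an element of \<open>\<S>\<close> and \<open>D\<^sub>u F\<close> the derivative of \<open>F\<close> in direction \<open>u\<close>.
  For star points \<open>p\<close>, \<open>q\<close> on a line in \<open>W\<close> with parameters \<open>s\<close>, \<open>t\<close>, the vector
  \<open>x = D\<^sub>u F(p) w - D\<^sub>w F(p) u\<close> is tangent at \<open>p\<close>, and invariance of \<open>F\<close> under translation by \<open>p\<close> on
  the tangent hyperplane together with homogeneity shows that
  \<open>D\<^sub>u F(p) D\<^sub>w F(q) - D\<^sub>w F(p) D\<^sub>u F(q) = D\<^sub>x F(q)\<close> is \<open>(t - s)\<close> to the power \<open>d - 1\<close> times a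
  factor depending only on \<open>s\<close>. The left-hand side is an alternating kernel of rank at most 2, so for
  \<open>d - 1 \<ge> 2\<close> it vanishes: the tangent hyperplane \<open>T\<close> is the same at all star points of \<open>W\<close>. Hence
  \<open>F\<close> restricted to \<open>T\<close> is invariant under \<open>W\<close>, i.e. a multiple of the \<open>d\<close>-th power of a linear form
  with kernel \<open>W\<close>, and a nonzero one because \<open>F\<close> has no linear factor. Any other \<open>W'\<close> of the family
  then satisfies \<open>W' \<inter> T \<subseteq> W\<close>, so it meets \<open>W\<close> in codimension 1; subspaces that pairwise meet
  in codimension 1 all contain a common one or all lie in a common one.
\<close>

section \<open>Evaluation of polynomials\<close>

definition mon_eval :: "('n::finite \<Rightarrow>\<^sub>0 nat) \<Rightarrow> complex ^ 'n \<Rightarrow> complex" where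
  "mon_eval m v = (\<Prod>i\<in>UNIV. (v $ i) ^ Poly_Mapping.lookup m i)"

lemma mon_eval_0 [simp]: "mon_eval 0 v = 1"
  by (simp add: mon_eval_def)

lemma mon_eval_add: "mon_eval (m + m') v = mon_eval m v * mon_eval m' v"
  by (simp add: mon_eval_def lookup_add power_add prod.distrib)

lemma mon_eval_single_1: "mon_eval (Poly_Mapping.single i 1) v = v $ i"
proof -
  have "mon_eval (Poly_Mapping.single i 1) v = (\<Prod>j\<in>UNIV. if j = i then v $ i else 1)"
    unfolding mon_eval_def by (intro prod.cong) (auto simp: lookup_single when_def)
  then show ?thesis by simp
qed

lemma cpoly_eval_superset:
  assumes "finite A" "Poly_Mapping.keys F \<subseteq> A"
  shows "cpoly_eval F v = (\<Sum>m\<in>A. Poly_Mapping.lookup F m * mon_eval m v)"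
  unfolding cpoly_eval_def mon_eval_def
  by (rule sum.mono_neutral_left[OF assms]) (auto simp: in_keys_iff)

lemma cpoly_eval_0 [simp]: "cpoly_eval 0 v = 0"
  by (simp add: cpoly_eval_def)

lemma cpoly_eval_single [simp]: "cpoly_eval (Poly_Mapping.single m c) v = c * mon_eval m v"
  by (subst cpoly_eval_superset[where A = "{m}"]) auto

lemma cpoly_eval_1 [simp]: "cpoly_eval 1 v = 1"
  by (metis cpoly_eval_single mon_eval_0 mult_1 single_one)

lemma cpoly_eval_add [simp]: "cpoly_eval (F + G) v = cpoly_eval F v + cpoly_eval G v"
proof -
  let ?A = "Poly_Mapping.keys F \<union> Poly_Mapping.keys G"
  have "cpoly_eval H v = (\<Sum>m\<in>?A. Poly_Mapping.lookup H m * mon_eval m v)"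
    if "Poly_Mapping.keys H \<subseteq> ?A" for H
    using that by (intro cpoly_eval_superset) auto
  then show ?thesis
    using keys_add[of F G] by (simp add: lookup_add distrib_right sum.distrib)
qed

lemma cpoly_eval_sum [simp]: "cpoly_eval (\<Sum>x\<in>A. f x) v = (\<Sum>x\<in>A. cpoly_eval (f x) v)"
  by (induction A rule: infinite_finite_induct) auto

lemma cpoly_eq_sum_monomials:
  "(F :: ('n::finite) cpoly) =
     (\<Sum>m\<in>Poly_Mapping.keys F. Poly_Mapping.single m (Poly_Mapping.lookup F m))"
  by (intro poly_mapping_eqI) (auto simp: lookup_sum lookup_single when_def in_keys_iff)

lemma cpoly_eval_mult [simp]: "cpoly_eval (F * G) v = cpoly_eval F v * cpoly_eval G v"
proof -
  let ?K = "Poly_Mapping.keys" and ?c = "Poly_Mapping.lookup"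
  have "F * G = (\<Sum>m\<in>?K F. Poly_Mapping.single m (?c F m)) * (\<Sum>m\<in>?K G. Poly_Mapping.single m (?c G m))"
    by (rule arg_cong2[where f = "(*)"]; rule cpoly_eq_sum_monomials)
  also have "\<dots> = (\<Sum>m\<in>?K F. \<Sum>m'\<in>?K G. Poly_Mapping.single (m + m') (?c F m * ?c G m'))"
    by (simp add: sum_product mult_single)
  finally have "cpoly_eval (F * G) v =
      (\<Sum>m\<in>?K F. \<Sum>m'\<in>?K G. (?c F m * mon_eval m v) * (?c G m' * mon_eval m' v))"
    by (simp add: mon_eval_add mult_ac)
  then show ?thesis
    by (simp add: cpoly_eval_def mon_eval_def sum_product)
qed

lemma cpoly_eval_uminus [simp]: "cpoly_eval (- F) v = - cpoly_eval F v"
  using cpoly_eval_add[of F "- F" v] by (simp add: add_eq_0_iff)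

lemma cpoly_eval_diff [simp]: "cpoly_eval (F - G) v = cpoly_eval F v - cpoly_eval G v"
  using cpoly_eval_add[of F "- G" v] by simp

lemma cpoly_eval_power [simp]: "cpoly_eval (F ^ k) v = cpoly_eval F v ^ k"
  by (induction k) auto

lemma cpoly_eval_prod [simp]: "cpoly_eval (\<Prod>x\<in>A. f x) v = (\<Prod>x\<in>A. cpoly_eval (f x) v)"
  by (induction A rule: infinite_finite_induct) auto

lemma cpoly_eval_var [simp]: "cpoly_eval (cpoly_var i) v = v $ i"
  unfolding cpoly_var_def by (simp only: cpoly_eval_single mon_eval_single_1) simp

lemma cpoly_eval_subst: "cpoly_eval (cpoly_subst g F) v = cpoly_eval F (\<chi> i. cpoly_eval (g i) v)"
  unfolding cpoly_subst_def by (simp add: cpoly_eval_def[of F])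

lemma cpoly_eval_not_involves:
  assumes "\<not> involves F j" "\<And>i. i \<noteq> j \<Longrightarrow> v $ i = w $ i"
  shows "cpoly_eval F v = cpoly_eval F w"
  unfolding cpoly_eval_def
proof (intro sum.cong refl arg_cong2[where f = "(*)"] prod.cong)
  fix m i assume "m \<in> Poly_Mapping.keys F"
  then show "(v $ i) ^ Poly_Mapping.lookup m i = (w $ i) ^ Poly_Mapping.lookup m i"
    using assms unfolding involves_def by (cases "i = j") auto
qed

lemma cpoly_eval_homogeneous:
  assumes "homogeneous d F"
  shows "cpoly_eval F (c *s v) = c ^ d * cpoly_eval F v"
proof -
  have "(\<Prod>i\<in>UNIV. (c * v $ i) ^ Poly_Mapping.lookup m i) =
        c ^ d * (\<Prod>i\<in>UNIV. (v $ i) ^ Poly_Mapping.lookup m i)" if "m \<in> Poly_Mapping.keys F" for m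
  proof -
    have "(\<Prod>i\<in>UNIV. (c * v $ i) ^ Poly_Mapping.lookup m i) =
        (\<Prod>i\<in>UNIV. c ^ Poly_Mapping.lookup m i) * (\<Prod>i\<in>UNIV. (v $ i) ^ Poly_Mapping.lookup m i)"
      by (simp add: power_mult_distrib prod.distrib)
    also have "(\<Prod>i\<in>UNIV. c ^ Poly_Mapping.lookup m i) = c ^ d"
      using assms that unfolding homogeneous_def by (simp flip: power_sum)
    finally show ?thesis .
  qed
  then show ?thesis
    unfolding cpoly_eval_def by (simp add: sum_distrib_left mult_ac)
qed

section \<open>Restriction to lines and the vanishing of polynomials\<close>

lemma cpoly_eval_on_line:
  obtains q :: "complex poly" where "\<And>s. cpoly_eval F (v + s *s w) = poly q s"
proof
  fix s
  show "cpoly_eval F (v + s *s w) = poly (\<Sum>m\<in>Poly_Mapping.keys F.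
     [:Poly_Mapping.lookup F m:] * (\<Prod>i\<in>UNIV. [:v $ i, w $ i:] ^ Poly_Mapping.lookup m i)) s"
    unfolding cpoly_eval_def by (simp add: poly_sum poly_prod poly_power mult.commute)
qed

lemma cpoly_eval_line_finite_zeros:
  assumes "cpoly_eval F (v + s0 *s w) \<noteq> 0"
  shows "finite {s. cpoly_eval F (v + s *s w) = 0}"
proof -
  obtain q where q: "\<And>s. cpoly_eval F (v + s *s w) = poly q s"
    using cpoly_eval_on_line by blast
  with assms have "q \<noteq> 0" by auto
  then show ?thesis unfolding q by (rule poly_roots_finite)
qed

text \<open>Positional notation, built up one coordinate at a time: with a base exceeding all values
  of the new coordinate on \<open>K\<close>, that coordinate becomes the lowest digit and the
  earlier weighted sum the remaining part.\<close>

lemma ex_separating_weights: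
  fixes K :: "('a \<Rightarrow> nat) set"
  assumes "finite K" "finite A"
  shows "\<exists>w :: 'a \<Rightarrow> nat. \<forall>m\<in>K. \<forall>m'\<in>K. (\<Sum>i\<in>A. w i * m i) = (\<Sum>i\<in>A. w i * m' i) \<longrightarrow>
    (\<forall>i\<in>A. m i = m' i)"
  using assms(2)
proof (induction A rule: finite_induct)
  case (insert a A)
  then obtain w where w: "\<And>m m' i. \<lbrakk>m \<in> K; m' \<in> K; (\<Sum>i\<in>A. w i * m i) = (\<Sum>i\<in>A. w i * m' i); i \<in> A\<rbrakk>
      \<Longrightarrow> m i = m' i"
    by blast
  define M where "M = Suc (\<Sum>m\<in>K. m a)"
  have M: "m a < M" if "m \<in> K" for m
    unfolding M_def using member_le_sum[OF that, of "\<lambda>m. m a"] assms(1) by (simp add: le_imp_less_Suc)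
  define w' where "w' i = (if i = a then 1 else M * w i)" for i
  have w': "(\<Sum>i\<in>insert a A. w' i * m i) = m a + M * (\<Sum>i\<in>A. w i * m i)" for m
  proof -
    have "(\<Sum>i\<in>A. w' i * m i) = M * (\<Sum>i\<in>A. w i * m i)"
      unfolding sum_distrib_left w'_def using insert.hyps by (intro sum.cong) auto
    then show ?thesis using insert.hyps by (simp add: w'_def)
  qed
  show ?case
  proof (intro exI[of _ w'] ballI impI)
    fix m m' i
    assume m: "m \<in> K" "m' \<in> K" and i: "i \<in> insert a A"
      and eq: "(\<Sum>i\<in>insert a A. w' i * m i) = (\<Sum>i\<in>insert a A. w' i * m' i)"
    from eq have eq: "m a + M * (\<Sum>i\<in>A. w i * m i) = m' a + M * (\<Sum>i\<in>A. w i * m' i)"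
      by (simp only: w')
    have "m a = m' a"
      using arg_cong[OF eq, of "\<lambda>x. x mod M"] M m by simp
    moreover have "M \<noteq> 0" by (simp add: M_def)
    ultimately have "(\<Sum>i\<in>A. w i * m i) = (\<Sum>i\<in>A. w i * m' i)" using eq by simp
    then show "m i = m' i" using w m i \<open>m a = m' a\<close> by blast
  qed
qed simp

text \<open>Substituting powers of one variable with exponents that separate the monomials of the
  polynomial leaves a nonzero univariate polynomial.\<close>

lemma cpoly_eq_0I:
  fixes F :: "('n::finite) cpoly"
  assumes "\<And>v. cpoly_eval F v = 0"
  shows "F = 0"
proof (rule ccontr)
  assume "F \<noteq> 0"
  then obtain m0 where m0: "m0 \<in> Poly_Mapping.keys F"
    by (metis keys_eq_empty ex_in_conv)
  obtain w :: "'n \<Rightarrow> nat" where w0: "\<forall>l\<in>Poly_Mapping.lookup ` Poly_Mapping.keys F.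
      \<forall>l'\<in>Poly_Mapping.lookup ` Poly_Mapping.keys F.
        (\<Sum>i\<in>UNIV. w i * l i) = (\<Sum>i\<in>UNIV. w i * l' i) \<longrightarrow> (\<forall>i\<in>UNIV. l i = l' i)"
    using ex_separating_weights[OF finite_imageI[OF finite_keys] finite_class.finite_UNIV] ..
  have w: "m = m'" if "m \<in> Poly_Mapping.keys F" "m' \<in> Poly_Mapping.keys F"
      "(\<Sum>i\<in>UNIV. w i * Poly_Mapping.lookup m i) = (\<Sum>i\<in>UNIV. w i * Poly_Mapping.lookup m' i)" for m m'
    by (rule poly_mapping_eqI) (use w0 that in blast)
  define e where "e m = (\<Sum>i\<in>UNIV. w i * Poly_Mapping.lookup m i)" for m
  define q where "q = (\<Sum>m\<in>Poly_Mapping.keys F. monom (Poly_Mapping.lookup F m) (e m))"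
  have "poly q x = cpoly_eval F (\<chi> i. x ^ w i)" for x
    unfolding q_def cpoly_eval_def e_def poly_sum poly_monom power_sum power_mult by simp
  with assms have "\<forall>x. poly q x = 0" by simp
  then have "q = 0" by (simp only: poly_all_0_iff_0)
  \<comment> \<open>Since \<open>e\<close> is injective on the monomials of \<open>F\<close>, only
    \<open>m0\<close> contributes in this degree.\<close>
  moreover have "coeff q (e m0) = (\<Sum>m\<in>Poly_Mapping.keys F. if m = m0 then Poly_Mapping.lookup F m else 0)"
    unfolding q_def coeff_sum coeff_monom using w m0 by (intro sum.cong) (auto simp: e_def)
  ultimately show False using m0 by (simp add: in_keys_iff)
qed

section \<open>Directional derivatives\<close>

definition dir_deriv :: "('n::finite) cpoly \<Rightarrow> complex ^ 'n \<Rightarrow> complex ^ 'n \<Rightarrow> complex" where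
  "dir_deriv F v u = (\<Sum>i\<in>UNIV. cpoly_eval (partial_deriv i F) v * u $ i)"

lemma cpoly_eval_partial_deriv:
  "cpoly_eval (partial_deriv i F) v = (\<Sum>m\<in>Poly_Mapping.keys F. Poly_Mapping.lookup F m *
     (of_nat (Poly_Mapping.lookup m i) * (v $ i) ^ (Poly_Mapping.lookup m i - 1) *
       (\<Prod>j\<in>UNIV - {i}. (v $ j) ^ Poly_Mapping.lookup m j)))"
proof -
  have "mon_eval (m - Poly_Mapping.single i 1) v =
      (v $ i) ^ (Poly_Mapping.lookup m i - 1) * (\<Prod>j\<in>UNIV - {i}. (v $ j) ^ Poly_Mapping.lookup m j)" for m
  proof -
    have "(\<Prod>j\<in>UNIV - {i}. (v $ j) ^ Poly_Mapping.lookup (m - Poly_Mapping.single i 1) j) =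
      (\<Prod>j\<in>UNIV - {i}. (v $ j) ^ Poly_Mapping.lookup m j)"
      by (intro prod.cong) (auto simp: lookup_minus lookup_single)
    then show ?thesis
      unfolding mon_eval_def by (subst prod.remove[of UNIV i]) (auto simp: lookup_minus)
  qed
  then show ?thesis
    unfolding partial_deriv_def by (simp add: mult_ac)
qed

text \<open>The formal derivative is identified with the analytic one along a line, so that rules
  for \<open>dir_deriv\<close> follow from identities between values of \<open>F\<close> by
  uniqueness of derivatives.\<close>

lemma cpoly_eval_has_dir_deriv:
  "((\<lambda>s. cpoly_eval F (v + s *s u)) has_field_derivative dir_deriv F v u) (at 0)"
proof -
  have "((\<lambda>s. \<Prod>i\<in>UNIV. (v $ i + s * u $ i) ^ Poly_Mapping.lookup m i) has_field_derivative
      (\<Sum>i\<in>UNIV. of_nat (Poly_Mapping.lookup m i) * (v $ i) ^ (Poly_Mapping.lookup m i - 1) * u $ i *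
       (\<Prod>j\<in>UNIV - {i}. (v $ j) ^ Poly_Mapping.lookup m j))) (at 0)" for m :: "'a \<Rightarrow>\<^sub>0 nat"
  proof -
    have "((\<lambda>s. (v $ i + s * u $ i) ^ Poly_Mapping.lookup m i) has_field_derivative
        of_nat (Poly_Mapping.lookup m i) * (v $ i) ^ (Poly_Mapping.lookup m i - 1) * u $ i) (at 0)" for i
      by (auto intro!: derivative_eq_intros)
    from has_field_derivative_prod[where A = UNIV, OF this] show ?thesis by simp
  qed
  from DERIV_cmult[OF this]
  have "((\<lambda>s. \<Sum>m\<in>Poly_Mapping.keys F. Poly_Mapping.lookup F m *
        (\<Prod>i\<in>UNIV. (v $ i + s * u $ i) ^ Poly_Mapping.lookup m i)) has_field_derivative
      (\<Sum>m\<in>Poly_Mapping.keys F. Poly_Mapping.lookup F m * (\<Sum>i\<in>UNIV. of_nat (Poly_Mapping.lookup m i) * (v $ i) ^ (Poly_Mapping.lookup m i - 1) * u $ i *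
       (\<Prod>j\<in>UNIV - {i}. (v $ j) ^ Poly_Mapping.lookup m j)))) (at 0)"
    by (intro DERIV_sum)
  also have "(\<Sum>m\<in>Poly_Mapping.keys F. Poly_Mapping.lookup F m * (\<Sum>i\<in>UNIV. of_nat (Poly_Mapping.lookup m i) * (v $ i) ^ (Poly_Mapping.lookup m i - 1) * u $ i *
       (\<Prod>j\<in>UNIV - {i}. (v $ j) ^ Poly_Mapping.lookup m j))) = dir_deriv F v u"
    unfolding dir_deriv_def cpoly_eval_partial_deriv sum_distrib_left sum_distrib_right
    by (subst sum.swap) (simp add: mult_ac)
  finally show ?thesis
    unfolding cpoly_eval_def by simp
qed

text \<open>The chain rule for multiplication of the parameter by \<open>a\<close>. Translation
  invariance is the case \<open>k = a = 1\<close>, homogeneity the case \<open>k = c ^ d\<close>,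
  \<open>a = 1 / c\<close>.\<close>

lemma dir_deriv_eqI:
  assumes "\<And>s. cpoly_eval F (v + s *s u) = k * cpoly_eval F (w + (a * s) *s u)"
  shows "dir_deriv F v u = k * a * dir_deriv F w u"
proof -
  have "((\<lambda>s. a * s) has_field_derivative a) (at 0)"
    by (auto intro!: derivative_eq_intros)
  from DERIV_chain2[OF _ this, of "\<lambda>s. cpoly_eval F (w + s *s u)"] cpoly_eval_has_dir_deriv[of F w u]
  have "((\<lambda>s. cpoly_eval F (w + (a * s) *s u)) has_field_derivative dir_deriv F w u * a) (at 0)"
    by simp
  from DERIV_cmult[OF this, of k]
  have "((\<lambda>s. cpoly_eval F (v + s *s u)) has_field_derivative k * (dir_deriv F w u * a)) (at 0)"
    by (simp add: assms)
  from DERIV_unique[OF cpoly_eval_has_dir_deriv this] show ?thesis by simp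
qed

lemma dir_deriv_eq_0I:
  assumes "\<And>s. cpoly_eval F (v + s *s u) = 0"
  shows "dir_deriv F v u = 0"
  using dir_deriv_eqI[of F v u 0 0 0] assms by simp

lemma dir_deriv_add: "dir_deriv F v (u + w) = dir_deriv F v u + dir_deriv F v w"
  by (simp add: dir_deriv_def distrib_left sum.distrib)

lemma dir_deriv_scale: "dir_deriv F v (c *s u) = c * dir_deriv F v u"
  by (simp add: dir_deriv_def sum_distrib_left mult_ac)

lemma dir_deriv_diff: "dir_deriv F v (u - w) = dir_deriv F v u - dir_deriv F v w"
  by (simp add: dir_deriv_def right_diff_distrib sum_subtractf)

lemma dir_deriv_axis: "dir_deriv F v (axis i 1) = cpoly_eval (partial_deriv i F) v"
  by (simp add: dir_deriv_def axis_def if_distrib cong: if_cong)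

lemma dir_deriv_homogeneous:
  assumes "homogeneous d F" "d \<ge> 2"
  shows "dir_deriv F (c *s v) u = c ^ (d - 1) * dir_deriv F v u"
proof (cases "c = 0")
  case True
  \<comment> \<open>On a line through the origin \<open>F\<close> is a multiple of
    \<open>s ^ d\<close>, whose derivative at 0 vanishes because \<open>d \<ge> 2\<close>.\<close>
  have "((\<lambda>s. s ^ d * cpoly_eval F u) has_field_derivative 0) (at 0)"
    using assms(2) by (auto intro!: derivative_eq_intros)
  then have "((\<lambda>s. cpoly_eval F (0 + s *s u)) has_field_derivative 0) (at 0)"
    by (simp add: cpoly_eval_homogeneous[OF assms(1)])
  from DERIV_unique[OF cpoly_eval_has_dir_deriv this] show ?thesis
    using True assms(2) by (simp add: zero_power)
next
  case False
  have "dir_deriv F (c *s v) u = c ^ d * (1 / c) * dir_deriv F v u"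
  proof (rule dir_deriv_eqI)
    fix s
    have "c *s v + s *s u = c *s (v + (1 / c * s) *s u)"
      using False by (simp add: vec_eq_iff field_simps)
    then show "cpoly_eval F (c *s v + s *s u) = c ^ d * cpoly_eval F (v + (1 / c * s) *s u)"
      using cpoly_eval_homogeneous[OF assms(1)] by metis
  qed
  also have "c ^ d * (1 / c) = c ^ (d - 1)"
    using False assms(2) by (cases d) auto
  finally show ?thesis .
qed

section \<open>Forms vanishing on a hyperplane\<close>

lemma dvd_power_diff:
  fixes L :: "'a::comm_ring_1"
  assumes "L dvd a - b"
  shows "L dvd a ^ k - b ^ k"
proof (induction k)
  case (Suc k)
  have "a ^ Suc k - b ^ Suc k = a * (a ^ k - b ^ k) + (a - b) * b ^ k"
    by (simp add: algebra_simps)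
  then show ?case using Suc assms by (metis dvd_add dvd_mult dvd_mult2)
qed simp

lemma dvd_prod_diff:
  fixes L :: "'a::comm_ring_1"
  assumes "\<And>i. i \<in> A \<Longrightarrow> L dvd f i - g i"
  shows "L dvd prod f A - prod g A"
  using assms
proof (induction A rule: infinite_finite_induct)
  case (insert x A)
  have "prod f (insert x A) - prod g (insert x A) =
      f x * (prod f A - prod g A) + (f x - g x) * prod g A"
    using insert.hyps by (simp add: algebra_simps)
  moreover have "L dvd prod f A - prod g A" "L dvd f x - g x"
    using insert by auto
  ultimately show ?case by (metis dvd_add dvd_mult dvd_mult2)
qed auto

lemma cpoly_subst_var: "cpoly_subst cpoly_var F = (F :: ('n::finite) cpoly)"
proof -
  have "cpoly_eval (cpoly_subst cpoly_var F - F) v = 0" for v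
    by (simp add: cpoly_eval_subst)
  then show ?thesis by (metis cpoly_eq_0I eq_iff_diff_eq_0)
qed

text \<open>Congruence modulo \<open>L\<close> passes through sums and products.\<close>

lemma dvd_cpoly_subst_diff:
  fixes F :: "('n::finite) cpoly"
  assumes "\<And>i. L dvd g i - g' i"
  shows "L dvd cpoly_subst g F - cpoly_subst g' F"
  unfolding cpoly_subst_def sum_subtractf[symmetric] right_diff_distrib[symmetric]
  by (intro dvd_sum dvd_mult dvd_prod_diff dvd_power_diff assms)

text \<open>Modulo a linear form with nonzero coefficient at the \<open>k\<close>-th variable, that variable is a
  linear combination of the others.\<close>

lemma linear_form_dvd:
  fixes F :: "('n::finite) cpoly" and c :: "'n \<Rightarrow> complex"
  assumes "c k \<noteq> 0" and vanish: "\<And>y. (\<Sum>i\<in>UNIV. c i * y $ i) = 0 \<Longrightarrow> cpoly_eval F y = 0"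
  shows "(\<Sum>i\<in>UNIV. Poly_Mapping.single 0 (c i) * cpoly_var i) dvd F"
proof -
  define L where "L = (\<Sum>i\<in>UNIV. Poly_Mapping.single 0 (c i) * cpoly_var i)"
  define g where "g i = (if i = k then cpoly_var k - Poly_Mapping.single 0 (1 / c k) * L else cpoly_var i)" for i
  have "L dvd cpoly_var i - g i" for i
    by (auto simp: g_def)
  then have "L dvd cpoly_subst cpoly_var F - cpoly_subst g F"
    by (rule dvd_cpoly_subst_diff)
  \<comment> \<open>The substitution \<open>g\<close> projects onto the hyperplane, where
    \<open>F\<close> vanishes: it subtracts exactly the value of the linear form.\<close>
  moreover have "cpoly_subst g F = 0"
  proof (rule cpoly_eq_0I)
    fix v
    let ?y = "\<chi> i. cpoly_eval (g i) v"
    have L: "cpoly_eval L v = (\<Sum>i\<in>UNIV. c i * v $ i)"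
      by (simp add: L_def)
    have "c i * ?y $ i = c i * v $ i - (if i = k then cpoly_eval L v else 0)" for i
      using assms(1) by (simp add: g_def field_simps)
    then have "(\<Sum>i\<in>UNIV. c i * ?y $ i) = 0"
      by (simp add: sum_subtractf L)
    from vanish[OF this] show "cpoly_eval (cpoly_subst g F) v = 0"
      by (simp add: cpoly_eval_subst)
  qed
  ultimately show ?thesis
    unfolding L_def[symmetric] by (simp add: cpoly_subst_var)
qed

text \<open>Along each line through the origin, \<open>U\<close> and its inverse become univariate
  polynomials with product 1, hence constants.\<close>

lemma cpoly_eval_unit:
  assumes "U dvd 1"
  shows "cpoly_eval U v = cpoly_eval U 0" "cpoly_eval U 0 \<noteq> 0"
proof -
  from assms obtain V where UV: "1 = U * V" by (auto simp: dvd_def)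
  have 1: "cpoly_eval U v * cpoly_eval V v = 1" for v
    using arg_cong[OF UV, of "\<lambda>P. cpoly_eval P v"] by simp
  show "cpoly_eval U 0 \<noteq> 0" using 1[of 0] by auto
  obtain p where p: "\<And>s. cpoly_eval U (0 + s *s v) = poly p s"
    using cpoly_eval_on_line by blast
  obtain q where q: "\<And>s. cpoly_eval V (0 + s *s v) = poly q s"
    using cpoly_eval_on_line by blast
  have "\<forall>s. poly (p * q - 1) s = 0"
    using 1 by (simp flip: p q)
  then have "p * q - 1 = 0" by (simp only: poly_all_0_iff_0)
  then have "p dvd 1" by (metis dvd_triv_left eq_iff_diff_eq_0)
  then obtain a where "p = [:a:]" by (auto simp: is_unit_poly_iff)
  with p[of 0] p[of 1] show "cpoly_eval U v = cpoly_eval U 0" by simp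
qed

text \<open>Otherwise the linear form divides \<open>F\<close>, the cofactor is a unit by
  irreducibility, and \<open>F\<close> has degree 1, against \<open>d \<ge> 2\<close>.\<close>

lemma irreducible_form_not_vanishing_on_hyperplane:
  fixes F :: "('n::finite) cpoly" and c :: "'n \<Rightarrow> complex"
  assumes "irreducible F" "homogeneous d F" "d \<ge> 2" "c k \<noteq> 0"
  obtains y where "(\<Sum>i\<in>UNIV. c i * y $ i) = 0" "cpoly_eval F y \<noteq> 0"
proof -
  define L where "L = (\<Sum>i\<in>UNIV. Poly_Mapping.single 0 (c i) * cpoly_var i)"
  have L: "cpoly_eval L v = (\<Sum>i\<in>UNIV. c i * v $ i)" for v
    by (simp add: L_def)
  have "\<not> L dvd F"
  proof
    assume "L dvd F"
    then obtain Q where Q: "F = L * Q" by (auto simp: dvd_def)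
    with assms(1) have "L dvd 1 \<or> Q dvd 1" by (auto simp: irreducible_def)
    moreover have "\<not> L dvd 1" using cpoly_eval_unit(2)[of L] by (auto simp: L)
    ultimately have "Q dvd 1" by blast
    note Q0 = cpoly_eval_unit[OF this]
    define v where "v = axis k (1 :: complex)"
    have Fv: "cpoly_eval F (s *s v) = s * (c k * cpoly_eval Q 0)" for s
    proof -
      have "cpoly_eval L (s *s v) = (\<Sum>i\<in>UNIV. if i = k then c k * s else 0)"
        unfolding L v_def by (intro sum.cong) (auto simp: axis_def)
      then show ?thesis unfolding Q by (simp add: Q0(1)[of "s *s v"])
    qed
    \<comment> \<open>Doubling \<open>v\<close> compares the degree 1 of the factorization with the
      degree \<open>d\<close> of \<open>F\<close>.\<close>
    have "2 ^ d * (c k * cpoly_eval Q 0) = 2 * (c k * cpoly_eval Q 0)"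
      using Fv[of 2] Fv[of 1] cpoly_eval_homogeneous[OF assms(2), of 2 v] by simp
    then have "(2 :: complex) ^ d = 2 ^ 1"
      using assms(4) Q0(2) by simp
    then have "(2 :: nat) ^ d = 2 ^ 1"
      by (metis of_nat_eq_iff of_nat_numeral of_nat_power)
    then show False using assms(3) by (subst (asm) power_inject_exp) auto
  qed
  then show thesis
    using linear_form_dvd[of c k F] assms(4) that unfolding L_def by blast
qed

section \<open>Constancy of the Gauss map\<close>

text \<open>The mixed terms are positive. At \<open>m = 1\<close> there is equality, in accordance
  with \<open>t - s\<close> being a kernel of rank 2.\<close>

lemma power_add_less:
  fixes x y :: real
  assumes "x > 0" "y > 0" "m \<ge> 2"
  shows "x ^ m + y ^ m < (x + y) ^ m"
  using assms(3)
proof (induction m rule: dec_induct)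
  case base
  then show ?case using assms by (simp add: power2_eq_square algebra_simps)
next
  case (step m)
  have "x ^ Suc m + y ^ Suc m < (x + y) * (x ^ m + y ^ m)"
    using assms by (simp add: algebra_simps add_pos_pos)
  also have "\<dots> < (x + y) * (x + y) ^ m"
    using step assms by (intro mult_strict_left_mono) auto
  finally show ?case by simp
qed

text \<open>The values of the kernel \<open>A s * B t - B s * A t\<close> satisfy the three-term Pluecker relation,
  whereas those of \<open>(t - s) ^ m\<close> do not.\<close>

lemma power_kernel_rank:
  fixes A B c :: "complex \<Rightarrow> complex"
  assumes "finite Z" "0 \<notin> Z" "m \<ge> 2"
    and kernel: "\<And>s t. s \<notin> Z \<Longrightarrow> A s * B t - B s * A t = (t - s) ^ m * c s"
  shows "c 0 = 0"
proof (rule ccontr)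
  assume c0: "c 0 \<noteq> 0"
  have "infinite {n :: nat. of_nat n \<notin> Z}"
  proof -
    have "finite ((of_nat :: nat \<Rightarrow> complex) -` Z)"
      using assms(1) by (intro finite_vimageI) (auto simp: inj_def)
    moreover have "{n :: nat. of_nat n \<notin> Z} = - (of_nat -` Z)" by auto
    ultimately show ?thesis by (simp add: finite_compl)
  qed
  then have unb: "\<exists>n>k. of_nat n \<notin> Z" for k :: nat
    unfolding infinite_nat_iff_unbounded by blast
  \<comment> \<open>Together with 0 these give four admissible parameters; natural numbers in
    increasing order make the final comparison one of positive reals.\<close>
  obtain i j k :: nat where ijk: "0 < i" "i < j" "j < k" "of_nat i \<notin> Z" "of_nat j \<notin> Z" "of_nat k \<notin> Z"
    using unb by meson
  define a b e :: complex where abe: "a = of_nat i" "b = of_nat j" "e = of_nat k"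
  have good: "0 \<notin> Z" "a \<notin> Z" "b \<notin> Z" "e \<notin> Z" and ne: "a \<noteq> 0" "b \<noteq> 0" "e \<noteq> 0" "a \<noteq> b" "a \<noteq> e" "b \<noteq> e"
    using ijk assms(2) by (auto simp: abe)
  have anti: "(t - s) ^ m * c s = - ((s - t) ^ m * c t)" if "s \<notin> Z" "t \<notin> Z" for s t
  proof -
    have "A s * B t - B s * A t = - (A t * B s - B t * A s)" by simp
    then show ?thesis unfolding kernel[OF that(1)] kernel[OF that(2)] .
  qed
  show False
  proof (cases "even m")
    case True
    \<comment> \<open>Exchanging the arguments of the alternating kernel flips the sign of
      \<open>c\<close>; three distinct admissible parameters then force
      \<open>c 0 = - c 0\<close>.\<close>
    have "c s = - c t" if "s \<notin> Z" "t \<notin> Z" "s \<noteq> t" for s t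
    proof -
      have "(s - t) ^ m = (t - s) ^ m" using True by (metis minus_diff_eq power_minus_even)
      with anti[OF that(1,2)] have "(t - s) ^ m * c s = (t - s) ^ m * (- c t)" by simp
      then show ?thesis using that(3) by (subst (asm) mult_cancel_left) simp
    qed
    from this[of 0 a] this[of a b] this[of 0 b] good ne c0 show False by simp
  next
    case False
    have cc: "c s = c t" if "s \<notin> Z" "t \<notin> Z" "s \<noteq> t" for s t
    proof -
      have "(s - t) ^ m = - ((t - s) ^ m)" using False by (metis minus_diff_eq power_minus_odd)
      then show ?thesis using anti[OF that(1,2)] that(3) by auto
    qed
    define K where "K s t = A s * B t - B s * A t" for s t
    \<comment> \<open>The Pluecker relation at 0, \<open>a\<close>, \<open>b\<close>,
      \<open>e\<close>. As \<open>c\<close> is constant on admissible parameters, it becomes an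
      equation between \<open>m\<close>-th powers.\<close>
    have "K 0 a * K b e - K 0 b * K a e + K 0 e * K a b = 0"
      by (simp add: K_def algebra_simps)
    moreover have "K 0 t = t ^ m * c 0" "K a t = (t - a) ^ m * c 0" "K b t = (t - b) ^ m * c 0" for t
      using kernel[of 0 t] kernel[of a t] kernel[of b t] cc[of a 0] cc[of b 0] good ne
      by (auto simp: K_def)
    ultimately have "c 0 ^ 2 * ((a * (e - b)) ^ m - (b * (e - a)) ^ m + (e * (b - a)) ^ m) = 0"
      unfolding power_mult_distrib by (simp add: power2_eq_square algebra_simps)
    then have "(a * (e - b)) ^ m - (b * (e - a)) ^ m + (e * (b - a)) ^ m = 0"
      using c0 by (simp only: mult_eq_0_iff power_eq_0_iff) simp
    then have eq: "(a * (e - b)) ^ m + (e * (b - a)) ^ m = (b * (e - a)) ^ m"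
      by (metis add_diff_eq diff_add_eq eq_iff_diff_eq_0)
    \<comment> \<open>The bases satisfy \<open>a * (e - b) + e * (b - a) = b * (e - a)\<close>, so
      the equation reads \<open>x ^ m + y ^ m = (x + y) ^ m\<close> with positive \<open>x\<close>
      and \<open>y\<close>.\<close>
    define x y where "x = real i * (real k - real j)" "y = real k * (real j - real i)"
    have "x > 0" "y > 0" using ijk by (auto simp: x_y_def)
    moreover have "x + y = real j * (real k - real i)" by (simp add: x_y_def algebra_simps)
    moreover have "of_real (x ^ m + y ^ m) = (of_real ((real j * (real k - real i)) ^ m) :: complex)"
      using eq by (simp add: x_y_def abe)
    ultimately show False
      using power_add_less[of x y m] assms(3) unfolding of_real_eq_iff by simp
  qed
qed

text \<open>Coordinate-free form of a star point represented by \<open>p\<close>: the gradient is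
  nonzero at \<open>p\<close>, and on the tangent hyperplane \<open>F\<close> is independent of the
  coordinate in direction \<open>p\<close>.\<close>

definition star_vector :: "('n::finite) cpoly \<Rightarrow> complex ^ 'n \<Rightarrow> bool" where
  "star_vector F p \<longleftrightarrow> (\<exists>u. dir_deriv F p u \<noteq> 0) \<and>
     (\<forall>y t. dir_deriv F p y = 0 \<longrightarrow> cpoly_eval F (y + t *s p) = cpoly_eval F y)"

text \<open>All points of the open subset \<open>h \<noteq> 0\<close> of \<open>W\<close> are star points.\<close>

definition star_space :: "('n::finite) cpoly \<Rightarrow> 'n cpoly \<Rightarrow> (complex ^ 'n) set \<Rightarrow> bool" where
  "star_space F h W \<longleftrightarrow> vec.subspace W \<and> (\<forall>v\<in>W. cpoly_eval F v = 0) \<and>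
     (\<exists>p\<in>W. cpoly_eval h p \<noteq> 0) \<and> (\<forall>v\<in>W. cpoly_eval h v \<noteq> 0 \<longrightarrow> star_vector F v)"

text \<open>The whole line through \<open>y\<close> in direction \<open>x\<close> lies in the
  tangent hyperplane at \<open>p\<close>, so translation by a multiple of \<open>p\<close> preserves
  \<open>F\<close> along it.\<close>

lemma dir_deriv_star_vector_translate:
  assumes "star_vector F p" "dir_deriv F p x = 0" "dir_deriv F p y = 0"
  shows "dir_deriv F (y + t *s p) x = dir_deriv F y x"
proof -
  have "dir_deriv F (y + t *s p) x = 1 * 1 * dir_deriv F y x"
  proof (rule dir_deriv_eqI)
    fix s
    have "dir_deriv F p (y + s *s x) = 0"
      using assms by (simp add: dir_deriv_add dir_deriv_scale)
    then have "cpoly_eval F ((y + s *s x) + t *s p) = cpoly_eval F (y + s *s x)"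
      using assms(1) unfolding star_vector_def by blast
    then show "cpoly_eval F (y + t *s p + s *s x) = 1 * cpoly_eval F (y + (1 * s) *s x)"
      by (simp add: add_ac)
  qed
  then show ?thesis by simp
qed

section \<open>The tangent hyperplane along a star space\<close>

lemma star_space_tangent:
  assumes "star_space F h W" "p \<in> W" "w \<in> W"
  shows "dir_deriv F p w = 0"
  using assms unfolding star_space_def
  by (intro dir_deriv_eq_0I) (meson vec.subspace_add vec.subspace_scale)

lemma star_space_gauss_constant:
  assumes F: "homogeneous d F" "d \<ge> 3" and W: "star_space F h W"
    and p: "p \<in> W" "cpoly_eval h p \<noteq> 0" and q: "q \<in> W" "cpoly_eval h q \<noteq> 0"
    and u: "dir_deriv F p u = 0"
  shows "dir_deriv F q u = 0"
proof -
  define r where "r = q - p"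
  have W': "vec.subspace W" using W by (simp add: star_space_def)
  then have r: "r \<in> W" using p q by (simp add: r_def vec.subspace_diff)
  define P where "P s = p + s *s r" for s
  have PW: "P s \<in> W" for s using W' p r by (simp add: P_def vec.subspace_add vec.subspace_scale)
  \<comment> \<open>A direction transversal to the tangent hyperplane at \<open>p\<close>; it makes
    \<open>B 0\<close> nonzero.\<close>
  obtain w where w: "dir_deriv F p w \<noteq> 0"
    using W p by (auto simp: star_space_def star_vector_def)
  define A where "A s = dir_deriv F (P s) u" for s
  define B where "B s = dir_deriv F (P s) w" for s
  define x where "x s = A s *s w - B s *s u" for s
  define c where "c s = dir_deriv F r (x s)" for s
  define Z where "Z = {s. cpoly_eval h (P s) = 0}"
  have kernel: "A s * B t - B s * A t = (t - s) ^ (d - 1) * c s" if "s \<notin> Z" for s t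
  proof -
    have star: "star_vector F (P s)"
      using W PW that by (auto simp: star_space_def Z_def)
    have x0: "dir_deriv F (P s) (x s) = 0"
      by (simp add: x_def A_def B_def dir_deriv_diff dir_deriv_scale)
    have r0: "dir_deriv F (P s) r = 0"
      using star_space_tangent[OF W PW r] .
    have "A s * B t - B s * A t = dir_deriv F (P t) (x s)"
      by (simp add: x_def A_def B_def dir_deriv_diff dir_deriv_scale)
    also have "\<dots> = (t - s) ^ (d - 1) * c s"
    proof (cases "t = s")
      case True
      then show ?thesis using x0 F(2) by (simp add: zero_power)
    next
      case False
      \<comment> \<open>Up to the factor \<open>t - s\<close>, the point \<open>P t\<close> is
        \<open>r\<close> translated by a multiple of \<open>P s\<close>. Homogeneity extracts the
        power, and the star property at \<open>P s\<close> removes the translation.\<close>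
      have "P t = (t - s) *s (r + (1 / (t - s)) *s P s)"
        using False by (simp add: P_def vec_eq_iff field_simps)
      then have "dir_deriv F (P t) (x s) =
          dir_deriv F ((t - s) *s (r + (1 / (t - s)) *s P s)) (x s)"
        by (rule arg_cong)
      also have "\<dots> = (t - s) ^ (d - 1) * dir_deriv F (r + (1 / (t - s)) *s P s) (x s)"
        using F by (intro dir_deriv_homogeneous) auto
      finally show ?thesis
        using dir_deriv_star_vector_translate[OF star x0 r0] by (simp add: c_def)
    qed
    finally show ?thesis .
  qed
  have "cpoly_eval h (p + 0 *s r) \<noteq> 0" using p by simp
  then have "finite Z" unfolding Z_def P_def by (rule cpoly_eval_line_finite_zeros)
  moreover have Z0: "0 \<notin> Z" using p by (simp add: Z_def P_def)
  \<comment> \<open>Here \<open>d \<ge> 3\<close> enters, as \<open>d - 1 \<ge> 2\<close>. Since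
    \<open>A 0 = 0\<close>, the kernel at the parameters 0 and 1 then leaves
    \<open>B 0 * A 1 = 0\<close>.\<close>
  ultimately have "c 0 = 0"
    using power_kernel_rank[where m = "d - 1", OF _ _ _ kernel] F(2) by simp
  with kernel[OF Z0, of 1] have "A 0 * B 1 = B 0 * A 1" by simp
  moreover have "A 0 = 0" "B 0 \<noteq> 0" "A 1 = dir_deriv F q u"
    using u w by (simp_all add: A_def B_def P_def r_def)
  ultimately show ?thesis by simp
qed

text \<open>Each \<open>w\<close> in \<open>W\<close> is the difference of
  \<open>(1 / s) *s (p + s *s w)\<close> and \<open>(1 / s) *s p\<close>, multiples of star vectors
  for suitable \<open>s\<close>. As the tangent hyperplane is constant, the two translations can be
  made one after the other.\<close>

lemma star_space_translate:
  assumes F: "homogeneous d F" "d \<ge> 3" and W: "star_space F h W"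
    and p: "p \<in> W" "cpoly_eval h p \<noteq> 0" and w: "w \<in> W" and y: "dir_deriv F p y = 0"
  shows "cpoly_eval F (y + w) = cpoly_eval F y"
proof -
  have W': "vec.subspace W" using W by (simp add: star_space_def)
  have translate: "cpoly_eval F (y + t *s q) = cpoly_eval F y"
    if "q \<in> W" "cpoly_eval h q \<noteq> 0" "dir_deriv F p y = 0" for q y t
  proof -
    have "star_vector F q" using W that by (simp add: star_space_def)
    moreover have "dir_deriv F q y = 0"
      using star_space_gauss_constant[OF F W p that] .
    ultimately show ?thesis by (simp add: star_vector_def)
  qed
  have "finite {s. cpoly_eval h (p + s *s w) = 0}"
    using p by (intro cpoly_eval_line_finite_zeros[of _ _ 0]) simp
  \<comment> \<open>The parameter 0 is excluded because of the division by \<open>s\<close>.\<close>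
  then have "finite (insert 0 {s. cpoly_eval h (p + s *s w) = 0})" by simp
  then obtain s where "s \<notin> insert 0 {s. cpoly_eval h (p + s *s w) = 0}"
    using ex_new_if_finite[OF infinite_UNIV_char_0] by blast
  then have s: "s \<noteq> 0" "cpoly_eval h (p + s *s w) \<noteq> 0" by auto
  define z where "z = y + (- (1 / s)) *s p"
  have z: "dir_deriv F p z = 0"
    using y star_space_tangent[OF W p(1) p(1)]
    by (simp add: z_def dir_deriv_diff dir_deriv_scale)
  have "y + w = z + (1 / s) *s (p + s *s w)"
    using s(1) by (simp add: z_def vec_eq_iff field_simps)
  then have "cpoly_eval F (y + w) = cpoly_eval F z"
    using translate[OF _ s(2) z, of "1 / s"] W' p w
    by (simp only: vec.subspace_add vec.subspace_scale)
  also have "\<dots> = cpoly_eval F y"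
    unfolding z_def using translate[OF p y] .
  finally show ?thesis .
qed

section \<open>Star points\<close>

lemma line_of_obtain:
  obtains p where "p \<noteq> 0" "line_of P = vec.span {p}"
proof -
  have l: "vec.subspace (line_of P)" "vec.dim (line_of P) = 1"
    using line_of[of P] by auto
  obtain B where B: "B \<subseteq> line_of P" "vec.independent B" "line_of P \<subseteq> vec.span B" "card B = 1"
    using vec.basis_exists[of "line_of P"] l(2) by metis
  then obtain p where "B = {p}" by (auto simp: card_1_singleton_iff)
  moreover from this B have "p \<noteq> 0" by auto
  moreover have "vec.span B \<subseteq> line_of P"
    using B(1) l(1) by (rule vec.span_minimal)
  ultimately show thesis using that B(3) by blast
qed

lemma line_of_Proj_span:
  assumes "v \<noteq> 0"
  shows "line_of (Proj (vec.span {v})) = vec.span {v}"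
proof -
  have "vec.independent {v}" using assms by simp
  then have "vec.dim (vec.span {v}) = 1"
    by (simp add: vec.dim_span_eq_card_independent)
  then show ?thesis using vec.subspace_span by (intro Proj_inverse) blast
qed

lemma cpoly_eval_restrict_form:
  "cpoly_eval (restrict_form J b F) v = cpoly_eval F (\<Sum>j\<in>J. v $ j *s b j)"
proof -
  have "(\<chi> i. cpoly_eval (\<Sum>j\<in>J. Poly_Mapping.single 0 (b j $ i) * cpoly_var j) v) = (\<Sum>j\<in>J. v $ j *s b j)"
    by (simp add: vec_eq_iff sum_component mult.commute)
  then show ?thesis unfolding restrict_form_def cpoly_eval_subst by simp
qed

text \<open>At a multiple of \<open>p\<close>, including 0, the gradient is a multiple of the one at
  \<open>p\<close>, so one nonzero representative decides.\<close>

lemma tangent_hyperplane_eq: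
  assumes "homogeneous d F" "d \<ge> 2" "line_of P = vec.span {p}"
  shows "tangent_hyperplane F P = {y. dir_deriv F p y = 0}"
proof -
  have "p \<in> vec.span {p}" by (simp add: vec.span_base)
  then show ?thesis
    using assms(3) dir_deriv_homogeneous[OF assms(1,2)]
    by (auto simp: tangent_hyperplane_def vec.span_singleton simp flip: dir_deriv_def)
qed

text \<open>Since \<open>b j0\<close> is a nonzero multiple of \<open>p\<close>, translation along
  \<open>p\<close> changes only the coordinate that the restricted form does not involve.\<close>

lemma star_point_imp_star_vector:
  assumes F: "homogeneous d F" "d \<ge> 2" and P: "line_of P = vec.span {p}" and star: "star_point F P"
  shows "star_vector F p"
  unfolding star_vector_def
proof (intro conjI allI impI)
  from star obtain i v where "v \<in> line_of P" "cpoly_eval (partial_deriv i F) v \<noteq> 0"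
    unfolding star_point_def smooth_point_def zero_locus_def by blast
  moreover from this obtain a where "v = a *s p"
    unfolding P vec.span_singleton by blast
  ultimately have "dir_deriv F (a *s p) (axis i 1) \<noteq> 0"
    by (simp add: dir_deriv_axis)
  then have "dir_deriv F p (axis i 1) \<noteq> 0"
    by (simp add: dir_deriv_homogeneous[OF F])
  then show "\<exists>u. dir_deriv F p u \<noteq> 0" by blast
next
  fix y t
  assume y: "dir_deriv F p y = 0"
  obtain J b j0 where coords: "inj_on b J" "vec.independent (b ` J)"
      "vec.span (b ` J) = {y. dir_deriv F p y = 0}"
    and j0: "j0 \<in> J" "b j0 \<in> line_of P" "\<not> involves (restrict_form J b F) j0"
    using star unfolding star_point_def homogeneous_coordinates_def tangent_hyperplane_eq[OF F P]
    by blast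
  from j0(2) obtain k where k: "b j0 = k *s p"
    unfolding P vec.span_singleton by blast
  have "b j0 \<noteq> 0" using coords(2) j0(1) vec.dependent_zero by (metis imageI)
  then have k0: "k \<noteq> 0" using k by auto
  have fin: "finite J" by simp
  from y coords(3) have "y \<in> vec.span (b ` J)" by blast
  then obtain c where "y = (\<Sum>v\<in>b ` J. c v *s v)"
    using vec.span_finite[of "b ` J"] fin by auto
  then have y_eq: "y = (\<Sum>j\<in>J. c (b j) *s b j)"
    using coords(1) by (simp add: sum.reindex)
  define v where "v = (\<chi> j. c (b j))"
  \<comment> \<open>The shift is \<open>t / k\<close> because \<open>b j0 = k *s p\<close>.\<close>
  define v' where "v' = (\<chi> j. c (b j) + (if j = j0 then t / k else 0))"
  have "(\<Sum>j\<in>J. v' $ j *s b j) = (\<Sum>j\<in>J. c (b j) *s b j + (if j = j0 then (t / k) *s b j0 else 0))"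
    by (intro sum.cong) (auto simp: v'_def vector_sadd_rdistrib)
  also have "\<dots> = y + (t / k) *s b j0"
    using j0(1) fin by (simp add: sum.distrib y_eq)
  also have "(t / k) *s b j0 = t *s p"
    using k0 by (simp add: k vector_smult_assoc)
  finally have "cpoly_eval F (y + t *s p) = cpoly_eval (restrict_form J b F) v'"
    by (simp add: cpoly_eval_restrict_form)
  also have "\<dots> = cpoly_eval (restrict_form J b F) v"
    using j0(3) by (rule cpoly_eval_not_involves) (simp add: v_def v'_def)
  also have "\<dots> = cpoly_eval F y"
    by (simp add: cpoly_eval_restrict_form y_eq v_def)
  finally show "cpoly_eval F (y + t *s p) = cpoly_eval F y" .
qed

lemma star_subspaces_obtain:
  fixes F :: "('n::finite) cpoly"
  assumes F: "homogeneous d F" "d \<ge> 2" and "\<Lambda> \<in> star_subspaces F"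
  obtains W h where "star_space F h W" "vec.dim W + 2 = CARD('n)" "\<Lambda> = {P. line_of P \<subseteq> W}"
proof -
  from assms(3) obtain W where W: "vec.subspace W" "int (vec.dim W) - 1 = int CARD('n) - 3"
      and \<Lambda>: "\<Lambda> = {P. line_of P \<subseteq> W}"
    unfolding star_subspaces_def proj_subspace_def by blast
  from assms(3) have zero: "\<Lambda> \<subseteq> zero_locus F" and "general_element \<Lambda> (star_point F)"
    unfolding star_subspaces_def by auto
  then obtain G P0 where G: "\<And>g. g \<in> G \<Longrightarrow> \<exists>k. homogeneous k g"
      and P0: "P0 \<notin> (\<Inter>g\<in>G. zero_locus g)" "P0 \<in> \<Lambda>"
      and star: "\<And>P. \<lbrakk>P \<notin> (\<Inter>g\<in>G. zero_locus g); P \<in> \<Lambda>\<rbrakk> \<Longrightarrow> star_point F P"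
    unfolding general_element_def zariski_open_def by blast
  \<comment> \<open>One equation of the closed complement that fails at \<open>P0\<close> suffices:
    wherever it is nonzero, the point belongs to the open set.\<close>
  from P0(1) obtain g v0 where g: "g \<in> G" and v0: "v0 \<in> line_of P0" "cpoly_eval g v0 \<noteq> 0"
    unfolding zero_locus_def by blast
  from G[OF g] obtain k where k: "homogeneous k g" by blast
  obtain p where p: "p \<noteq> 0" "line_of P0 = vec.span {p}"
    by (rule line_of_obtain)
  with v0 obtain a where "v0 = a *s p"
    unfolding vec.span_singleton by blast
  with v0 have gp: "cpoly_eval g p \<noteq> 0"
    by (simp add: cpoly_eval_homogeneous[OF k])
  have pW: "p \<in> W"
    using P0(2) p(2) vec.span_base[of p "{p}"] by (auto simp: \<Lambda>)
  from p(1) obtain i where i: "p $ i \<noteq> 0" by (auto simp: vec_eq_iff)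
  have line: "Proj (vec.span {v}) \<in> \<Lambda>" if "v \<in> W" "v \<noteq> 0" for v
    using that W(1) by (auto simp: \<Lambda> line_of_Proj_span vec.span_minimal)
  \<comment> \<open>The extra variable, nonzero at \<open>p\<close>, excludes the zero vector, which
    represents no point.\<close>
  have "star_space F (g * cpoly_var i) W"
    unfolding star_space_def
  proof (intro conjI ballI impI)
    fix v assume v: "v \<in> W"
    show "cpoly_eval F v = 0"
    proof (cases "v = 0")
      case True
      then show ?thesis using cpoly_eval_homogeneous[OF F(1), of 0 0] F(2) by (simp add: zero_power)
    next
      case False
      then show ?thesis
        using line[OF v False] zero line_of_Proj_span[OF False] vec.span_base[of v "{v}"]
        unfolding zero_locus_def by blast
    qed
  next
    show "\<exists>p\<in>W. cpoly_eval (g * cpoly_var i) p \<noteq> 0"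
      using pW gp i by auto
  next
    fix v assume v: "v \<in> W" "cpoly_eval (g * cpoly_var i) v \<noteq> 0"
    then have v': "v \<noteq> 0" "cpoly_eval g v \<noteq> 0" by auto
    note l = line_of_Proj_span[OF v'(1)]
    have "Proj (vec.span {v}) \<notin> zero_locus g"
      using v'(2) vec.span_base[of v "{v}"] l unfolding zero_locus_def by blast
    then have "star_point F (Proj (vec.span {v}))"
      using star line[OF v(1) v'(1)] g by blast
    then show "star_vector F v"
      using star_point_imp_star_vector[OF F l] by blast
  qed (rule W(1))
  moreover have "vec.dim W + 2 = CARD('n)" using W(2) by linarith
  ultimately show thesis using that \<Lambda> by blast
qed

section \<open>Intersections of two star spaces\<close>

lemma star_space_Int_dim:
  fixes F :: "('n::finite) cpoly"
  assumes F: "homogeneous d F" "d \<ge> 3" "irreducible F"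
    and W: "star_space F h W" "vec.dim W + 2 = CARD('n)"
    and W': "star_space F h' W'" "vec.dim W' + 2 = CARD('n)"
  shows "vec.dim W \<le> vec.dim (W \<inter> W') + 1"
proof -
  obtain p where p: "p \<in> W" "cpoly_eval h p \<noteq> 0"
    using W(1) by (auto simp: star_space_def)
  then obtain u where u: "dir_deriv F p u \<noteq> 0"
    using W(1) by (auto simp: star_space_def star_vector_def)
  have sub: "vec.subspace W" "vec.subspace W'"
    using W(1) W'(1) by (auto simp: star_space_def)
  define T where "T = {y. dir_deriv F p y = 0}"
  have T: "vec.subspace T"
    by (rule vec.subspaceI) (auto simp: T_def dir_deriv_add dir_deriv_scale dir_deriv_def[of _ _ 0])
  have WT: "W \<subseteq> T"
    using star_space_tangent[OF W(1) p(1)] by (auto simp: T_def)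
  have "y \<in> vec.span (insert u T)" for y
  proof -
    \<comment> \<open>Subtracting a multiple of \<open>u\<close> makes every vector tangent, so
      \<open>T\<close> has codimension 1.\<close>
    have "y - (dir_deriv F p y / dir_deriv F p u) *s u \<in> T"
      using u by (simp add: T_def dir_deriv_diff dir_deriv_scale)
    then show ?thesis unfolding vec.span_breakdown_eq using vec.span_base by blast
  qed
  then have "vec.span (insert u T) = UNIV" by blast
  then have "vec.dim (insert u T) = CARD('n)"
    by (metis vec.dim_span vec_dim_card)
  moreover have "u \<notin> vec.span T"
    using u T unfolding vec.span_eq_iff[THEN iffD2, OF T] by (simp add: T_def)
  ultimately have dimT: "vec.dim T + 1 = CARD('n)"
    by (simp add: vec.dim_insert)
  have "W \<noteq> T" using dimT W(2) by auto
  with WT obtain e where e: "e \<in> T" "e \<notin> W" by blast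
  have spanW: "vec.span W = W" using sub(1) by simp
  have "vec.dim (vec.span (insert e W)) = vec.dim T"
    using e(2) dimT W(2) by (simp add: vec.dim_insert spanW)
  moreover have "vec.span (insert e W) \<subseteq> T"
    using e(1) WT T by (intro vec.span_minimal) auto
  ultimately have spanT: "vec.span (insert e W) = T"
    using T vec.subspace_span vec.subspace_dim_equal by (metis order_refl)
  \<comment> \<open>\<open>T\<close> is spanned by \<open>W\<close> and \<open>e\<close>; invariance
    under \<open>W\<close> leaves only the coordinate \<open>k\<close> along \<open>e\<close>, a
    linear form with kernel \<open>W\<close>.\<close>
  have F_T: "\<exists>k. y - k *s e \<in> W \<and> cpoly_eval F y = k ^ d * cpoly_eval F e" if y: "y \<in> T" for y
  proof -
    obtain k where k: "y - k *s e \<in> W"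
      using y unfolding spanT[symmetric] vec.span_breakdown_eq spanW by blast
    have "dir_deriv F p (k *s e) = 0" using e(1) by (simp add: T_def dir_deriv_scale)
    from star_space_translate[OF F(1,2) W(1) p k this]
    have "cpoly_eval F y = k ^ d * cpoly_eval F e"
      by (simp add: cpoly_eval_homogeneous[OF F(1)])
    with k show ?thesis by blast
  qed
  obtain k where "cpoly_eval (partial_deriv k F) p \<noteq> 0"
    using sum.not_neutral_contains_not_neutral[OF u[unfolded dir_deriv_def]] by auto
  then obtain y0 where "y0 \<in> T" "cpoly_eval F y0 \<noteq> 0"
    using irreducible_form_not_vanishing_on_hyperplane[OF F(3,1), of "\<lambda>i. cpoly_eval (partial_deriv i F) p" k]
      F(2) unfolding T_def dir_deriv_def by auto
  \<comment> \<open>Were \<open>F\<close> zero at \<open>e\<close>, it would vanish on all of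
    \<open>T\<close>.\<close>
  with F_T have Fe: "cpoly_eval F e \<noteq> 0" by fastforce
  have "W' \<inter> T \<subseteq> W \<inter> W'"
  proof
    fix y assume y: "y \<in> W' \<inter> T"
    then obtain k where k: "y - k *s e \<in> W" "cpoly_eval F y = k ^ d * cpoly_eval F e"
      using F_T by blast
    moreover have "cpoly_eval F y = 0" using y W'(1) by (auto simp: star_space_def)
    ultimately have "k = 0" using Fe by simp
    with k(1) y show "y \<in> W \<inter> W'" by simp
  qed
  then have "vec.dim (W' \<inter> T) \<le> vec.dim (W \<inter> W')" by (rule vec.dim_subset)
  \<comment> \<open>Intersecting \<open>W'\<close> with the hyperplane \<open>T\<close> lowers the
    dimension by at most 1, and \<open>W\<close> and \<open>W'\<close> have equal dimension.\<close>
  moreover have "vec.dim {x + y |x y. x \<in> W' \<and> y \<in> T} + vec.dim (W' \<inter> T) = vec.dim W' + vec.dim T"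
    using sub(2) T by (rule vec.dim_sums_Int)
  moreover have "vec.dim {x + y |x y. x \<in> W' \<and> y \<in> T} \<le> CARD('n)"
    by (rule dim_subset_UNIV_cart_gen)
  ultimately show ?thesis using dimT W(2) W'(2) by linarith
qed

section \<open>Subspaces that pairwise meet in codimension one\<close>

text \<open>The candidates are the intersection \<open>A\<close> and the sum \<open>H\<close> of two
  distinct members. A member not inside \<open>H\<close> meets \<open>H\<close> exactly in
  \<open>A\<close>; hence a member not containing \<open>A\<close> and one not inside
  \<open>H\<close> would have too small an intersection.\<close>

lemma subspaces_pairwise_codim_1:
  fixes \<W> :: "(complex ^ 'n::finite) set set"
  assumes \<W>: "\<And>W. W \<in> \<W> \<Longrightarrow> vec.subspace W" "\<And>W. W \<in> \<W> \<Longrightarrow> vec.dim W = k"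
    and codim: "\<And>W W'. \<lbrakk>W \<in> \<W>; W' \<in> \<W>\<rbrakk> \<Longrightarrow> k \<le> vec.dim (W \<inter> W') + 1"
    and W12: "W1 \<in> \<W>" "W2 \<in> \<W>" "W1 \<noteq> W2"
  shows "(\<exists>A. vec.subspace A \<and> vec.dim A + 1 = k \<and> (\<forall>W\<in>\<W>. A \<subseteq> W)) \<or>
         (\<exists>H. vec.subspace H \<and> vec.dim H = k + 1 \<and> (\<forall>W\<in>\<W>. W \<subseteq> H))"
proof -
  have less: "vec.dim S < vec.dim S'" if "vec.subspace S" "vec.subspace S'" "S \<subseteq> S'" "S \<noteq> S'"
    for S S' :: "(complex ^ 'n) set"
    using vec.subspace_dim_equal[OF that(1-3)] that(4) by force
  define A where "A = W1 \<inter> W2"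
  define H where "H = {x + y |x y. x \<in> W1 \<and> y \<in> W2}"
  have A: "vec.subspace A" and H: "vec.subspace H"
    using \<W>(1) W12 by (auto simp: A_def H_def intro: vec.subspace_inter vec.subspace_sums)
  have "W1 \<inter> W2 \<noteq> W1"
    using vec.subspace_dim_equal[of W1 W2] \<W> W12 by auto
  then have "vec.dim A < k"
    unfolding A_def using less[of "W1 \<inter> W2" W1] \<W> W12 by (auto intro: vec.subspace_inter)
  then have dimA: "vec.dim A + 1 = k"
    using codim[OF W12(1,2)] by (simp add: A_def)
  have "vec.dim H + vec.dim A = k + k"
    unfolding H_def A_def using vec.dim_sums_Int[of W1 W2] \<W> W12 by simp
  with dimA have dimH: "vec.dim H = k + 1" by simp
  have WH: "W1 \<subseteq> H" "W2 \<subseteq> H"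
  proof -
    have "0 \<in> W1" "0 \<in> W2" using \<W>(1) W12 vec.subspace_0 by auto
    then show "W1 \<subseteq> H" "W2 \<subseteq> H" unfolding H_def by force+
  qed
  have not_H: "W \<inter> H = A" if W: "W \<in> \<W>" "\<not> W \<subseteq> H" for W
  proof -
    have sub: "vec.subspace (W \<inter> H)" "vec.subspace (W \<inter> W1)" "vec.subspace (W \<inter> W2)"
      using W \<W>(1) W12 H by (auto intro: vec.subspace_inter)
    \<comment> \<open>\<open>W \<inter> H\<close> contains \<open>W \<inter> W1\<close> and
      \<open>W \<inter> W2\<close>, both of dimension at least \<open>k - 1\<close>; hence all three
      coincide.\<close>
    have "vec.dim (W \<inter> H) < k"
      using less[of "W \<inter> H" W] sub W \<W> by auto
    then have "vec.dim (W \<inter> H) \<le> vec.dim (W \<inter> W1)" "vec.dim (W \<inter> H) \<le> vec.dim (W \<inter> W2)"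
      using codim[OF W(1) W12(1)] codim[OF W(1) W12(2)] by linarith+
    then have "W \<inter> W1 = W \<inter> H" "W \<inter> W2 = W \<inter> H"
      using sub WH by (intro vec.subspace_dim_equal; blast)+
    then have "W \<inter> H \<subseteq> A" "vec.dim A \<le> vec.dim (W \<inter> H)"
      using codim[OF W(1) W12(1)] dimA by (auto simp: A_def)
    then show ?thesis using vec.subspace_dim_equal[OF sub(1) A] by blast
  qed
  show ?thesis
  proof (rule ccontr)
    assume contra: "\<not> ?thesis"
    with A dimA obtain W3 where W3: "W3 \<in> \<W>" "\<not> A \<subseteq> W3" by blast
    from contra H dimH obtain W4 where W4: "W4 \<in> \<W>" "\<not> W4 \<subseteq> H" by blast
    \<comment> \<open>Otherwise \<open>W3 \<inter> H = A\<close>, and \<open>W3\<close> would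
      contain \<open>A\<close>.\<close>
    have "W3 \<subseteq> H" using not_H W3 by blast
    then have "W3 \<inter> W4 \<subseteq> W3 \<inter> A" using not_H[OF W4] by blast
    then have "vec.dim (W3 \<inter> W4) \<le> vec.dim (W3 \<inter> A)" by (rule vec.dim_subset)
    also have "\<dots> < vec.dim A"
      using W3 \<W>(1) A by (intro less) (auto intro: vec.subspace_inter)
    finally show False using codim[OF W3(1) W4(1)] dimA by simp
  qed
qed

section \<open>From linear subspaces to projective ones\<close>

theorem proposition3p1:
  fixes F :: "('n::finite) cpoly" and N d :: nat
  assumes "CARD('n) = N + 1"
    and "d \<ge> 3" and "homogeneous d F" and "irreducible F"
    and "\<exists>\<Lambda>1 \<in> star_subspaces F. \<exists>\<Lambda>2 \<in> star_subspaces F. \<Lambda>1 \<noteq> \<Lambda>2"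
  shows "(\<exists>L. proj_subspace (int N - 3) L \<and> (\<forall>\<Lambda> \<in> star_subspaces F. L \<subseteq> \<Lambda>)) \<or>
         (\<exists>H. proj_subspace (int N - 1) H \<and> (\<forall>\<Lambda> \<in> star_subspaces F. \<Lambda> \<subseteq> H))"
proof -
  define \<W> where "\<W> = {W. (\<exists>h. star_space F h W) \<and> vec.dim W + 2 = CARD('n)}"
  have star: "\<exists>W\<in>\<W>. \<Lambda> = {P. line_of P \<subseteq> W}" if "\<Lambda> \<in> star_subspaces F" for \<Lambda>
  proof -
    have "d \<ge> 2" using assms(2) by simp
    from star_subspaces_obtain[OF assms(3) this that] obtain W h
      where W: "star_space F h W" "vec.dim W + 2 = CARD('n)" and \<Lambda>: "\<Lambda> = {P. line_of P \<subseteq> W}" .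
    from W have "W \<in> \<W>" unfolding \<W>_def by blast
    with \<Lambda> show ?thesis by (rule bexI)
  qed
  from assms(5) obtain \<Lambda>1 \<Lambda>2
    where \<Lambda>: "\<Lambda>1 \<in> star_subspaces F" "\<Lambda>2 \<in> star_subspaces F" "\<Lambda>1 \<noteq> \<Lambda>2"
    by blast
  obtain W1 where W1: "W1 \<in> \<W>" "\<Lambda>1 = {P. line_of P \<subseteq> W1}"
    using star[OF \<Lambda>(1)] by (elim bexE)
  obtain W2 where W2: "W2 \<in> \<W>" "\<Lambda>2 = {P. line_of P \<subseteq> W2}"
    using star[OF \<Lambda>(2)] by (elim bexE)
  have W12: "W1 \<in> \<W>" "W2 \<in> \<W>" "W1 \<noteq> W2"
    using W1 W2 \<Lambda>(3) by auto
  have "(\<exists>A. vec.subspace A \<and> vec.dim A + 1 = N - 1 \<and> (\<forall>W\<in>\<W>. A \<subseteq> W)) \<or>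
      (\<exists>H. vec.subspace H \<and> vec.dim H = N - 1 + 1 \<and> (\<forall>W\<in>\<W>. W \<subseteq> H))"
  proof (rule subspaces_pairwise_codim_1[OF _ _ _ W12])
    show "vec.subspace W" if "W \<in> \<W>" for W
      using that by (auto simp: \<W>_def star_space_def)
    show dim: "vec.dim W = N - 1" if "W \<in> \<W>" for W
      using that assms(1) by (auto simp: \<W>_def)
    show "N - 1 \<le> vec.dim (W \<inter> W') + 1" if "W \<in> \<W>" "W' \<in> \<W>" for W W'
      using star_space_Int_dim[OF assms(3,2,4)] that dim[OF that(1)] unfolding \<W>_def by force
  qed
  \<comment> \<open>This makes the truncated \<open>N - 1\<close> exact, so that the dimensions can
    be restated over the integers.\<close>
  moreover have "N \<ge> 1" using W12(1) assms(1) by (simp add: \<W>_def)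
  ultimately consider
      (vertex) A where "vec.subspace A" "int (vec.dim A) - 1 = int N - 3" "\<And>W. W \<in> \<W> \<Longrightarrow> A \<subseteq> W"
    | (hyperplane) H where "vec.subspace H" "int (vec.dim H) - 1 = int N - 1" "\<And>W. W \<in> \<W> \<Longrightarrow> W \<subseteq> H"
    by force
  then show ?thesis
  proof cases
    case vertex
    then have "proj_subspace (int N - 3) {P. line_of P \<subseteq> A}"
      unfolding proj_subspace_def by blast
    moreover have "{P. line_of P \<subseteq> A} \<subseteq> \<Lambda>" if "\<Lambda> \<in> star_subspaces F" for \<Lambda>
      using star[OF that] vertex(3) by blast
    ultimately show ?thesis by blast
  next
    case hyperplane
    then have "proj_subspace (int N - 1) {P. line_of P \<subseteq> H}"
      unfolding proj_subspace_def by blast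
    moreover have "\<Lambda> \<subseteq> {P. line_of P \<subseteq> H}" if "\<Lambda> \<in> star_subspaces F" for \<Lambda>
      using star[OF that] hyperplane(3) by blast
    ultimately show ?thesis by blast
  qed
qed

end
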